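(* Let $S$ be a regular ordered semigroup (without zero). The following conditions are equivalent: (1) $S$ is right inverse; (2) for every $a\in S$ and all $a',a''\in V_{\leq}(a)$, one has $a'\,\mathcal{R}\,a''$; (3) for all $e,f\in E_{\leq}(S)$, $ef\in (fSeSf]$; (4) for all $e,f\in E_{\leq}(S)$, $(eS]\cap (fS]=(efS]$; (5) for every $e\in E_{\leq}(S)$, every $x\in (Se]$ and every $x'\in V_{\leq}(x)$, one has $x'\in (eS]$.
   Context: An ordered semigroup $(S,\cdot,\leq)$ is a semigroup with a partial order such that $a\leq b$ implies $xa\leq xb$ and $ax\leq bx$ for all $x\in S$. Standing assumption: the ambient ordered semigroup $S$ has no zero element (an element $0$ with $0x=x0=0$ and $0\leq x$ for all $x\in S$). For $H\subseteq S$, $(H]=\{t\in S: t\leq h \text{ for some } h\in H\}$. For $a,b\in S$: $aS=\{as:s\in S\}$, $Sa=\{sa:s\in S\}$, $aSbSa=\{asbta: s,t\in S\}$, etc. $S$ is regular if $a\in (aSa]$ for every $a\in S$. A nonempty $I\subseteq S$ is a left (right) ideal if $SI\subseteq I$ ($IS\subseteq I$) and $(I]\subseteq I$. $L(a)$ and $R(a)$ denote the smallest left, respectively right, ideal containing $a$ (the principal left/right ideals). Green's relations: $a\,\mathcal{L}\,b$ iff $L(a)=L(b)$; $a\,\mathcal{R}\,b$ iff $R(a)=R(b)$. $E_{\leq}(S)=\{e\in S: e\leq e^2\}$ is the set of ordered idempotents. An element $b\in S$ is an inverse of $a\in S$ if $a\leq aba$ and $b\leq bab$; $V_{\leq}(a)$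 is the set of all inverses of $a$. A regular ordered semigroup $S$ is right inverse if every principal left ideal is generated by an $\mathcal{R}$-unique ordered idempotent, i.e. for every $a\in S$ there is $e\in E_{\leq}(S)$ with $L(a)=L(e)$, and any two $e,f\in E_{\leq}(S)$ with $L(e)=L(a)=L(f)$ satisfy $e\,\mathcal{R}\,f$. *)

theory Defs
  imports HOL.Hull "HOL-Library.Set_Algebras"
begin

text \<open>
  The ordered semigroup \<open>S\<close> is a type of the class below, so \<open>S\<close> itself is \<open>UNIV\<close>. Products such as
  \<open>aSbSa\<close> are written with the elementwise product of sets from \<open>Set_Algebras\<close>, as
  \<open>{a} * UNIV * {b} * UNIV * {a}\<close>. Properties of \<open>S\<close> as a whole are predicates on \<open>TYPE('a)\<close>.
\<close>

class ordered_semigroup_mult = semigroup_mult + order +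
  assumes le_mult_left: "a \<le> b \<Longrightarrow> x * a \<le> x * b"
    and le_mult_right: "a \<le> b \<Longrightarrow> a * x \<le> b * x"

text \<open>A zero is absorbing and also the least element.\<close>

definition is_zero :: "'a::ordered_semigroup_mult \<Rightarrow> bool"
  where "is_zero z \<longleftrightarrow> (\<forall>x. z * x = z \<and> x * z = z \<and> z \<le> x)"

text \<open>The set usually written \<open>(H]\<close>.\<close>

definition down :: "'a::ordered_semigroup_mult set \<Rightarrow> 'a set"
  where "down H = {t. \<exists>h\<in>H. t \<le> h}"

definition regular :: "'a::ordered_semigroup_mult itself \<Rightarrow> bool"
  where "regular TYPE('a) \<longleftrightarrow> (\<forall>a::'a. a \<in> down ({a} * UNIV * {a}))"

definition left_ideal :: "'a::ordered_semigroup_mult set \<Rightarrow> bool"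
  where "left_ideal I \<longleftrightarrow> I \<noteq> {} \<and> UNIV * I \<subseteq> I \<and> down I \<subseteq> I"

definition right_ideal :: "'a::ordered_semigroup_mult set \<Rightarrow> bool"
  where "right_ideal I \<longleftrightarrow> I \<noteq> {} \<and> I * UNIV \<subseteq> I \<and> down I \<subseteq> I"

definition principal_left_ideal :: "'a::ordered_semigroup_mult \<Rightarrow> 'a set"
  where "principal_left_ideal a = left_ideal hull {a}"

definition principal_right_ideal :: "'a::ordered_semigroup_mult \<Rightarrow> 'a set"
  where "principal_right_ideal a = right_ideal hull {a}"

definition green_R :: "'a::ordered_semigroup_mult \<Rightarrow> 'a \<Rightarrow> bool"
  where "green_R a b \<longleftrightarrow> principal_right_ideal a = principal_right_ideal b"

definition ordered_idempotents :: "'a::ordered_semigroup_mult set"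
  where "ordered_idempotents = {e. e \<le> e * e}"

definition inverses :: "'a::ordered_semigroup_mult \<Rightarrow> 'a set"
  where "inverses a = {b. a \<le> a * b * a \<and> b \<le> b * a * b}"

text \<open>
  Every principal left ideal is generated by an ordered idempotent, and this generator is unique up
  to Green's relation \<open>\<R>\<close>.
\<close>

definition right_inverse :: "'a::ordered_semigroup_mult itself \<Rightarrow> bool"
  where "right_inverse TYPE('a) \<longleftrightarrow> regular TYPE('a) \<and>
    (\<forall>a::'a.
      (\<exists>e\<in>ordered_idempotents. principal_left_ideal a = principal_left_ideal e) \<and>
      (\<forall>e\<in>ordered_idempotents. \<forall>f\<in>ordered_idempotents.
        principal_left_ideal e = principal_left_ideal a \<and>
        principal_left_ideal a = principal_left_ideal f \<longrightarrow> green_R e f))"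

end

theory Submission imports Defs begin

text \<open>
  In a regular ordered semigroup \<open>R(a) = (aS]\<close> and \<open>L(a) = (Sa]\<close>, so everything is about the
  preorders \<open>a \<in> (bS]\<close> and \<open>a \<in> (Sb]\<close>. Two devices replace the identities \<open>xe = x\<close>, \<open>ex = x\<close> of the
  unordered theory, which have no ordered counterpart. If \<open>i \<le> ze\<close> for ordered idempotents \<open>i, e\<close>,
  then \<open>ize\<close> is an ordered idempotent above \<open>i\<close> that satisfies \<open>ize \<le> ize \<cdot> e\<close>. If \<open>g \<le> ek\<close>, then
  \<open>kg\<close> is an inverse of \<open>ge\<close>; comparing it with an inverse of the form \<open>eyg\<close>, which is an ordered
  idempotent, gives \<open>kg \<R> ge\<close> as soon as inverses are \<open>\<R>\<close>-unique, whence \<open>g \<in> (egS]\<close>.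
\<close>

section \<open>Monotonicity and the relation \<open>a \<in> (bS]\<close>\<close>

lemma ordered_semigroup_mult_mono:
  fixes a b c d :: "'a::ordered_semigroup_mult"
  assumes "a \<le> b" "c \<le> d"
  shows "a * c \<le> b * d"
  using le_mult_left[OF assms(2)] le_mult_right[OF assms(1)] by (rule order_trans)

text \<open>Transitive in general; regularity makes it reflexive, and its symmetric part is then
  Green's relation \<open>\<R>\<close>.\<close>

definition right_below :: "'a::ordered_semigroup_mult \<Rightarrow> 'a \<Rightarrow> bool"
  where "right_below a b \<longleftrightarrow> (\<exists>s. a \<le> b * s)"

lemma right_belowI: "a \<le> b * s \<Longrightarrow> right_below a b"
  by (auto simp: right_below_def)

lemma right_below_trans:
  fixes a b c :: "'a::ordered_semigroup_mult"
  assumes "right_below a b" "right_below b c"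
  shows "right_below a c"
proof -
  obtain s t where "a \<le> b * s" "b \<le> c * t"
    using assms by (auto simp: right_below_def)
  then have "a \<le> c * t * s"
    using le_mult_right order_trans by blast
  then show ?thesis
    by (auto simp: right_below_def mult.assoc)
qed

lemma right_below_mult: "right_below (a * s) a"
  by (rule right_belowI) (rule order_refl)

lemma right_below_mult_cong:
  fixes a b c :: "'a::ordered_semigroup_mult"
  assumes "right_below a b"
  shows "right_below (c * a) (c * b)"
  using assms by (metis le_mult_left mult.assoc right_below_def)

lemma right_below_le: "a \<le> b \<Longrightarrow> right_below b c \<Longrightarrow> right_below a c"
  by (meson order_trans right_below_def)

lemma down_right_iff: "x \<in> down ({a} * UNIV) \<longleftrightarrow> right_below x a"
  by (auto simp: down_def set_times_def right_below_def)

lemma down_left_iff: "x \<in> down (UNIV * {a}) \<longleftrightarrow> (\<exists>s. x \<le> s * a)"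
  by (auto simp: down_def set_times_def)

section \<open>Principal ideals and Green's relation in the regular case\<close>

lemma regularE:
  fixes a :: "'a::ordered_semigroup_mult"
  assumes "regular TYPE('a)"
  obtains x where "a \<le> a * x * a"
  using assms by (auto simp: regular_def down_def set_times_def)

text \<open>In general \<open>R(a)\<close> is \<open>(a \<union> aS]\<close>; regularity gives
  \<open>a \<le> a * (x * a)\<close>, so \<open>a\<close> already lies in
  \<open>(aS]\<close>.\<close>

lemma principal_right_ideal_regular:
  fixes a :: "'a::ordered_semigroup_mult"
  assumes "regular TYPE('a)"
  shows "principal_right_ideal a = down ({a} * UNIV)"
  unfolding principal_right_ideal_def
proof (rule hull_unique)
  obtain x where "a \<le> a * x * a"
    using assms by (rule regularE)
  then have a: "a \<in> down ({a} * UNIV)"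
    by (simp add: down_right_iff mult.assoc right_belowI)
  then show "{a} \<subseteq> down ({a} * UNIV)"
    by simp
  have "y * s \<in> down ({a} * UNIV)" if "y \<in> down ({a} * UNIV)" for y s
    using that right_below_mult right_below_trans unfolding down_right_iff by blast
  moreover have "down (down ({a} * UNIV)) \<subseteq> down ({a} * UNIV)"
    unfolding down_def by (auto intro: order_trans)
  ultimately show "right_ideal (down ({a} * UNIV))"
    using a unfolding right_ideal_def by (auto simp: set_times_def)
next
  fix T :: "'a set"
  assume "{a} \<subseteq> T" "right_ideal T"
  then show "down ({a} * UNIV) \<subseteq> T"
    unfolding right_ideal_def down_def set_times_def by blast
qed

lemma principal_left_ideal_regular:
  fixes a :: "'a::ordered_semigroup_mult"
  assumes "regular TYPE('a)"
  shows "principal_left_ideal a = down (UNIV * {a})"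
  unfolding principal_left_ideal_def
proof (rule hull_unique)
  obtain x where "a \<le> a * x * a"
    using assms by (rule regularE)
  then have a: "a \<in> down (UNIV * {a})"
    by (auto simp: down_left_iff)
  then show "{a} \<subseteq> down (UNIV * {a})"
    by simp
  have "s * y \<in> down (UNIV * {a})" if "y \<in> down (UNIV * {a})" for y s
    using that le_mult_left unfolding down_left_iff by (metis mult.assoc)
  moreover have "down (down (UNIV * {a})) \<subseteq> down (UNIV * {a})"
    unfolding down_def by (auto intro: order_trans)
  ultimately show "left_ideal (down (UNIV * {a}))"
    using a unfolding left_ideal_def by (auto simp: set_times_def)
next
  fix T :: "'a set"
  assume "{a} \<subseteq> T" "left_ideal T"
  then show "down (UNIV * {a}) \<subseteq> T"
    unfolding left_ideal_def down_def set_times_def by blast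
qed

lemma right_below_refl_regular:
  fixes a :: "'a::ordered_semigroup_mult"
  assumes "regular TYPE('a)"
  shows "right_below a a"
  using assms by (metis mult.assoc regularE right_belowI)

lemma green_R_regular_iff:
  fixes a b :: "'a::ordered_semigroup_mult"
  assumes "regular TYPE('a)"
  shows "green_R a b \<longleftrightarrow> right_below a b \<and> right_below b a"
proof -
  have "green_R a b \<longleftrightarrow> (\<forall>x. right_below x a \<longleftrightarrow> right_below x b)"
    by (simp add: green_R_def principal_right_ideal_regular[OF assms] set_eq_iff down_right_iff)
  then show ?thesis
    using right_below_refl_regular[OF assms] right_below_trans by blast
qed

lemma principal_left_ideal_eqI:
  fixes a b s t :: "'a::ordered_semigroup_mult"
  assumes "regular TYPE('a)" "a \<le> s * b" "b \<le> t * a"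
  shows "principal_left_ideal a = principal_left_ideal b"
proof -
  have "down (UNIV * {a}) \<subseteq> down (UNIV * {b})" if le: "a \<le> s * b" for a b s :: 'a
  proof
    fix x
    assume "x \<in> down (UNIV * {a})"
    then obtain u where "x \<le> u * a"
      by (auto simp: down_left_iff)
    also have "u * a \<le> u * s * b"
      using le_mult_left[OF le, of u] by (simp add: mult.assoc)
    finally show "x \<in> down (UNIV * {b})"
      by (auto simp: down_left_iff)
  qed
  then show ?thesis
    using assms by (simp add: principal_left_ideal_regular subset_antisym)
qed

lemma principal_left_ideal_eqD:
  fixes a b :: "'a::ordered_semigroup_mult"
  assumes "regular TYPE('a)" "principal_left_ideal a = principal_left_ideal b"
  shows "\<exists>s. a \<le> s * b"
proof -
  have "a \<in> down (UNIV * {a})"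
    using regularE[OF assms(1), of a] down_left_iff by blast
  then show ?thesis
    using assms down_left_iff by (simp only: principal_left_ideal_regular) blast
qed

section \<open>Inverses and ordered idempotents\<close>

lemma inverses_nonempty:
  fixes a :: "'a::ordered_semigroup_mult"
  assumes "regular TYPE('a)"
  obtains b where "b \<in> inverses a"
proof -
  obtain x where x: "a \<le> a * x * a"
    using assms by (rule regularE)
  \<comment> \<open>The witness is \<open>x * a * x\<close>, as in the unordered theory. Each
    inequality replaces one factor \<open>a\<close> by \<open>a * x * a\<close>.\<close>
  have "a * x * a \<le> a * (x * a * x) * a"
    using le_mult_right[OF x, of "x * a"] by (simp add: mult.assoc)
  moreover have "x * a * x \<le> x * a * x * a * x"
    using le_mult_left[OF le_mult_right[OF x, of x], of x] by (simp add: mult.assoc)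
  moreover have "x * a * x * a * x \<le> x * a * x * a * x * a * x"
    using le_mult_left[OF le_mult_right[OF x, of "x * a * x"], of x] by (simp add: mult.assoc)
  ultimately have "x * a * x \<in> inverses a"
    using x unfolding inverses_def by (auto simp: mult.assoc intro: order_trans)
  then show thesis
    by (rule that)
qed

lemma inverses_sym: "b \<in> inverses a \<longleftrightarrow> a \<in> inverses b"
  by (auto simp: inverses_def)

lemma inverse_mult_idempotent: "b \<in> inverses a \<Longrightarrow> a * b \<in> ordered_idempotents"
  using le_mult_right by (fastforce simp: inverses_def ordered_idempotents_def mult.assoc)

lemma idempotent_self_inverse:
  fixes e :: "'a::ordered_semigroup_mult"
  assumes "e \<in> ordered_idempotents"
  shows "e \<in> inverses e"
proof -
  have "e \<le> e * e"
    using assms by (simp add: ordered_idempotents_def)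
  then have "e \<le> e * e * e"
    using le_mult_right order_trans by blast
  then show ?thesis
    by (simp add: inverses_def)
qed

lemma right_below_inverse_mult: "b \<in> inverses a \<Longrightarrow> right_below b (b * a)"
  by (auto simp: inverses_def intro: right_belowI)

text \<open>An ordered form of the sandwich set of \<open>e\<close> and \<open>f\<close>: since
  \<open>(f * x * e) * (f * x * e) = f * (x * (e * f) * x) * e\<close>, idempotency comes from
  \<open>x \<le> x * (e * f) * x\<close>.\<close>

lemma
  fixes e f x :: "'a::ordered_semigroup_mult"
  assumes "e \<in> ordered_idempotents" "f \<in> ordered_idempotents" "x \<in> inverses (e * f)"
  shows sandwich_idempotent: "f * x * e \<in> ordered_idempotents"
    and sandwich_inverse: "f * x * e \<in> inverses (e * f)"
proof -
  have e: "e \<le> e * e" and f: "f \<le> f * f"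
    using assms by (auto simp: ordered_idempotents_def)
  have ef: "e * f \<le> e * f * x * (e * f)" and x: "x \<le> x * (e * f) * x"
    using assms by (auto simp: inverses_def)
  have fxe: "f * x * e \<le> f * x * (e * f) * x * e"
    using le_mult_left[OF le_mult_right[OF x, of e], of f] by (simp add: mult.assoc)
  then show "f * x * e \<in> ordered_idempotents"
    by (simp add: ordered_idempotents_def mult.assoc)
  \<comment> \<open>Doubling \<open>e\<close> and \<open>f\<close> supplies the outer factors of
    \<open>f * x * e\<close>; the same is done below for the other inequality.\<close>
  have "e * f * x * (e * f) \<le> e * (f * f) * x * (e * e * f)"
    by (intro ordered_semigroup_mult_mono order_refl e f)
  with ef have "e * f \<le> e * f * (f * x * e) * (e * f)"
    by (simp add: mult.assoc)
  moreover have "f * x * (e * f) * x * e \<le> f * x * (e * e * (f * f)) * x * e"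
    by (intro ordered_semigroup_mult_mono order_refl e f)
  with fxe have "f * x * e \<le> f * x * e * (e * f) * (f * x * e)"
    by (simp add: mult.assoc)
  ultimately show "f * x * e \<in> inverses (e * f)"
    by (simp add: inverses_def)
qed

section \<open>The two devices for ordered idempotents\<close>

text \<open>Moves \<open>e\<close> from the right side of a bound to the left side. \<open>E\<close>
  is applied to \<open>?q\<close> and \<open>e\<close>, because \<open>?q \<le> ?q * e\<close> is
  available while \<open>i \<le> i * e\<close> is not.\<close>

lemma right_below_of_le_mult_idempotent:
  fixes e i z :: "'a::ordered_semigroup_mult"
  assumes E: "\<And>e f :: 'a. e \<in> ordered_idempotents \<Longrightarrow> f \<in> ordered_idempotents
      \<Longrightarrow> right_below (e * f) f"
    and i: "i \<in> ordered_idempotents" and e: "e \<in> ordered_idempotents" and le: "i \<le> z * e"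
  shows "right_below i e"
proof -
  let ?q = "i * z * e"
  have ii: "i \<le> i * i" and ee: "e \<le> e * e"
    using i e by (auto simp: ordered_idempotents_def)
  have iq: "i \<le> ?q"
    using ii le_mult_left[OF le, of i] by (simp add: mult.assoc)
  have "?q \<le> i * i * z * e"
    by (intro ordered_semigroup_mult_mono order_refl ii)
  also have "\<dots> \<le> ?q * i * z * e"
    by (intro ordered_semigroup_mult_mono order_refl iq)
  finally have "?q \<in> ordered_idempotents"
    by (simp add: ordered_idempotents_def mult.assoc)
  then have "right_below (?q * e) e"
    using E e by blast
  moreover have "?q \<le> ?q * e"
    using le_mult_left[OF ee, of "i * z"] by (simp add: mult.assoc)
  ultimately show ?thesis
    using iq right_below_le by blast
qed

text \<open>Replacing the middle factor of \<open>g \<le> g * g * g\<close> by \<open>e * k\<close>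
  gives \<open>g \<le> g * e * k * g\<close>. Up to doubling \<open>g\<close>, multiplying by
  \<open>e\<close> on the right gives one inequality, and by \<open>k\<close> on the left the
  other.\<close>

lemma mult_inverse_of_le_mult:
  fixes e g k :: "'a::ordered_semigroup_mult"
  assumes g: "g \<in> ordered_idempotents" and le: "g \<le> e * k"
  shows "k * g \<in> inverses (g * e)"
proof -
  have gg: "g \<le> g * g"
    using g by (simp add: ordered_idempotents_def)
  have "g \<le> g * g * g"
    using idempotent_self_inverse[OF g] by (simp add: inverses_def)
  also have "\<dots> \<le> g * (e * k) * g"
    by (intro ordered_semigroup_mult_mono order_refl le)
  also have "\<dots> \<le> g * (e * k) * (g * g)"
    by (intro ordered_semigroup_mult_mono order_refl gg)
  finally have gekgg: "g \<le> g * e * (k * g) * g"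
    by (simp add: mult.assoc)
  have "g * g * g \<le> g * (e * k) * g"
    by (intro ordered_semigroup_mult_mono order_refl le)
  then have "g \<le> g * e * k * g"
    using idempotent_self_inverse[OF g] by (auto simp: inverses_def mult.assoc intro: order_trans)
  then have "k * g \<le> k * (g * g * e * k * g)"
    using gg by (metis le_mult_left mult.assoc order_trans)
  then show ?thesis
    using le_mult_right[OF gekgg, of e] by (simp add: inverses_def mult.assoc)
qed

lemma right_below_mult_of_le_mult:
  fixes e g k :: "'a::ordered_semigroup_mult"
  assumes reg: "regular TYPE('a)"
    and uniq: "\<And>a b c :: 'a. b \<in> inverses a \<Longrightarrow> c \<in> inverses a \<Longrightarrow> right_below b c"
    and g: "g \<in> ordered_idempotents" and e: "e \<in> ordered_idempotents" and le: "right_below g e"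
  shows "right_below g (e * g)"
proof -
  obtain k where k: "g \<le> e * k"
    using le by (auto simp: right_below_def)
  obtain y where y: "y \<in> inverses (g * e)"
    using reg by (rule inverses_nonempty)
  let ?h = "e * y * g"
  have h: "?h \<in> inverses (g * e)" "?h \<in> ordered_idempotents"
    using sandwich_inverse[OF g e y] sandwich_idempotent[OF g e y] by auto
  have "right_below (k * g) ?h"
    using uniq mult_inverse_of_le_mult[OF g k] h(1) by blast
  \<comment> \<open>Both \<open>?h\<close> and \<open>g * e\<close> are inverses of the ordered
    idempotent \<open>?h\<close>.\<close>
  moreover have "right_below ?h (g * e)"
    using uniq idempotent_self_inverse[OF h(2)] h(1) inverses_sym by blast
  ultimately have "right_below (k * g) g"
    using right_below_mult right_below_trans by blast
  \<comment> \<open>Left multiplication by \<open>e\<close> leads back to \<open>g\<close>, since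
    \<open>g \<le> g * g \<le> e * k * g\<close>.\<close>
  then have "right_below (e * (k * g)) (e * g)"
    by (rule right_below_mult_cong)
  moreover have "g \<le> e * (k * g)"
    using g le_mult_right[OF k, of g]
    by (auto simp: ordered_idempotents_def mult.assoc intro: order_trans)
  ultimately show ?thesis
    using right_below_le by blast
qed

section \<open>Implications between the conditions\<close>

text \<open>For an inverse \<open>b\<close> of \<open>a\<close>, the ordered idempotent
  \<open>b * a\<close> generates \<open>L(a)\<close>. Swapping \<open>e\<close> and \<open>f\<close>
  turns the one-sided \<open>right_below\<close> into \<open>\<R>\<close>.\<close>

lemma right_inverse_iff:
  assumes reg: "regular TYPE('a::ordered_semigroup_mult)"
  shows "right_inverse TYPE('a) \<longleftrightarrow>
    (\<forall>e\<in>ordered_idempotents :: 'a set. \<forall>f\<in>ordered_idempotents.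
      principal_left_ideal e = principal_left_ideal f \<longrightarrow> right_below e f)"
proof -
  have "\<exists>e\<in>ordered_idempotents. principal_left_ideal a = principal_left_ideal e" for a :: 'a
  proof -
    obtain b where b: "b \<in> inverses a"
      using reg by (rule inverses_nonempty)
    then have "b * a \<in> ordered_idempotents"
      using inverse_mult_idempotent inverses_sym by blast
    moreover have "a \<le> a * (b * a)"
      using b by (simp add: inverses_def mult.assoc)
    then have "principal_left_ideal a = principal_left_ideal (b * a)"
      by (rule principal_left_ideal_eqI[OF reg]) (rule order_refl)
    ultimately show ?thesis
      by blast
  qed
  then show ?thesis
    using reg unfolding right_inverse_def green_R_regular_iff[OF reg] by metis
qed

text \<open>Both \<open>b * a\<close> and \<open>c * a\<close> are ordered idempotents generating
  the same left ideal, so \<open>b * a\<close> lies in \<open>(caS]\<close>, and \<open>b\<close>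
  lies in \<open>(baS]\<close>.\<close>

lemma right_inverse_imp_inverses_right_below:
  fixes a b c :: "'a::ordered_semigroup_mult"
  assumes reg: "regular TYPE('a)" and ri: "right_inverse TYPE('a)"
    and b: "b \<in> inverses a" and c: "c \<in> inverses a"
  shows "right_below b c"
proof -
  have "a \<le> a * (b * a)" "a \<le> a * (c * a)"
    using b c by (simp_all add: inverses_def mult.assoc)
  then have "b * a \<le> b * a * (c * a)" "c * a \<le> c * a * (b * a)"
    by (metis le_mult_left mult.assoc)+
  then have "principal_left_ideal (b * a) = principal_left_ideal (c * a)"
    by (rule principal_left_ideal_eqI[OF reg])
  moreover have "b * a \<in> ordered_idempotents" "c * a \<in> ordered_idempotents"
    using b c inverse_mult_idempotent inverses_sym by blast+
  ultimately have "right_below (b * a) (c * a)"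
    using ri right_inverse_iff[OF reg] by blast
  then show ?thesis
    using right_below_inverse_mult[OF b] right_below_mult right_below_trans by blast
qed

lemma idempotent_mult_in_down:
  fixes e f :: "'a::ordered_semigroup_mult"
  assumes reg: "regular TYPE('a)"
    and uniq: "\<And>a b c :: 'a. b \<in> inverses a \<Longrightarrow> c \<in> inverses a \<Longrightarrow> right_below b c"
    and e: "e \<in> ordered_idempotents" and f: "f \<in> ordered_idempotents"
  shows "e * f \<in> down ({f} * UNIV * {e} * UNIV * {f})"
proof -
  obtain x where x: "x \<in> inverses (e * f)"
    using reg by (rule inverses_nonempty)
  note h = sandwich_idempotent[OF e f x] sandwich_inverse[OF e f x]
  \<comment> \<open>The ordered idempotent \<open>f * x * e\<close> has both itself and
    \<open>e * f\<close> as inverses. This yields the first \<open>f\<close> and the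
    \<open>e\<close> of the sandwich; the last \<open>f\<close> comes from
    \<open>e * f \<le> e * f * x * (e * f)\<close>.\<close>
  have "right_below (e * f) (f * x * e)"
    using uniq idempotent_self_inverse[OF h(1)] h(2) inverses_sym by blast
  then obtain s where s: "e * f \<le> f * x * e * s"
    by (auto simp: right_below_def)
  have "e * f \<le> e * f * x * (e * f)"
    using x by (simp add: inverses_def)
  also have "\<dots> \<le> f * x * e * s * x * (e * f)"
    by (intro le_mult_right s)
  finally have "e * f \<le> f * x * e * (s * x * e) * f"
    by (simp add: mult.assoc)
  moreover have "f * x * e * (s * x * e) * f \<in> {f} * UNIV * {e} * UNIV * {f}"
    by (intro set_times_intro) simp_all
  ultimately show ?thesis
    by (auto simp: down_def)
qed

lemma down_sandwich_right_below:
  "x \<in> down ({f} * UNIV * {e} * UNIV * {f}) \<Longrightarrow> right_below x f"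
  by (auto simp: down_def set_times_def mult.assoc intro: right_belowI)

text \<open>Equal left ideals give \<open>e \<le> s * f\<close>, and the first device then puts
  \<open>e\<close> into \<open>(fS]\<close>.\<close>

lemma right_inverseI:
  assumes reg: "regular TYPE('a::ordered_semigroup_mult)"
    and E: "\<And>e f :: 'a. e \<in> ordered_idempotents \<Longrightarrow> f \<in> ordered_idempotents
      \<Longrightarrow> right_below (e * f) f"
  shows "right_inverse TYPE('a)"
  using right_below_of_le_mult_idempotent[OF E] principal_left_ideal_eqD[OF reg]
  unfolding right_inverse_iff[OF reg] by blast

text \<open>For the harder inclusion, \<open>t\<close> is replaced by the ordered idempotent
  \<open>g = t * t'\<close> with the same right ideal: \<open>g\<close> lies in \<open>(egS]\<close>
  by the second device, and \<open>g \<in> (fS]\<close> gives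
  \<open>(egS] \<subseteq> (efS]\<close>.\<close>

lemma down_Int_down:
  fixes e f :: "'a::ordered_semigroup_mult"
  assumes reg: "regular TYPE('a)"
    and uniq: "\<And>a b c :: 'a. b \<in> inverses a \<Longrightarrow> c \<in> inverses a \<Longrightarrow> right_below b c"
    and e: "e \<in> ordered_idempotents" and f: "f \<in> ordered_idempotents"
  shows "down ({e} * UNIV) \<inter> down ({f} * UNIV) = down ({e * f} * UNIV)"
proof -
  have "right_below t (e * f)" if te: "right_below t e" and tf: "right_below t f" for t
  proof -
    obtain t' where t': "t' \<in> inverses t"
      using reg by (rule inverses_nonempty)
    have g: "t * t' \<in> ordered_idempotents"
      using t' by (rule inverse_mult_idempotent)
    have le: "right_below (t * t') e" "right_below (t * t') f"
      using right_below_mult right_below_trans te tf by blast+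
    have "right_below (t * t') (e * (t * t'))"
      using reg uniq g e le(1) by (rule right_below_mult_of_le_mult)
    then have "right_below (t * t') (e * f)"
      using right_below_mult_cong[OF le(2)] by (rule right_below_trans)
    moreover have "right_below t (t * t')"
      using t' inverses_sym right_below_inverse_mult by blast
    ultimately show ?thesis
      using right_below_trans by blast
  qed
  moreover have "right_below (e * f) f"
    using idempotent_mult_in_down[OF reg uniq e f] by (rule down_sandwich_right_below)
  then have "right_below t e \<and> right_below t f" if "right_below t (e * f)" for t
    using that right_below_mult right_below_trans by blast
  ultimately show ?thesis
    by (auto simp: down_right_iff)
qed

text \<open>The first device applies to the ordered idempotent \<open>x' * x\<close>, which lies in
  \<open>(Se]\<close>; moreover \<open>x'\<close> lies in \<open>(x'xS]\<close>.\<close>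

lemma inverse_right_below:
  fixes e x x' :: "'a::ordered_semigroup_mult"
  assumes E: "\<And>e f :: 'a. e \<in> ordered_idempotents \<Longrightarrow> f \<in> ordered_idempotents
      \<Longrightarrow> right_below (e * f) f"
    and e: "e \<in> ordered_idempotents" and x: "x \<in> down (UNIV * {e})" and x': "x' \<in> inverses x"
  shows "right_below x' e"
proof -
  obtain s where "x \<le> s * e"
    using x by (auto simp: down_left_iff)
  then have "x' * x \<le> x' * s * e"
    by (simp add: le_mult_left mult.assoc)
  moreover have "x' * x \<in> ordered_idempotents"
    using x' inverse_mult_idempotent inverses_sym by blast
  ultimately have "right_below (x' * x) e"
    using right_below_of_le_mult_idempotent[OF E _ e] by blast
  then show ?thesis
    using right_below_inverse_mult[OF x'] right_below_trans by blast
qed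

theorem theorem3p6:
  assumes "regular TYPE('a::ordered_semigroup_mult)"
    and "\<nexists>z::'a. is_zero z"
  shows
    "(right_inverse TYPE('a) \<longleftrightarrow>
       (\<forall>a::'a. \<forall>a'\<in>inverses a. \<forall>a''\<in>inverses a. green_R a' a'')) \<and>
     (right_inverse TYPE('a) \<longleftrightarrow>
       (\<forall>e\<in>ordered_idempotents :: 'a set. \<forall>f\<in>ordered_idempotents.
          e * f \<in> down ({f} * UNIV * {e} * UNIV * {f}))) \<and>
     (right_inverse TYPE('a) \<longleftrightarrow>
       (\<forall>e\<in>ordered_idempotents :: 'a set. \<forall>f\<in>ordered_idempotents.
          down ({e} * UNIV) \<inter> down ({f} * UNIV) = down ({e * f} * UNIV))) \<and>
     (right_inverse TYPE('a) \<longleftrightarrow>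
       (\<forall>e\<in>ordered_idempotents :: 'a set. \<forall>x\<in>down (UNIV * {e}).
          \<forall>x'\<in>inverses x. x' \<in> down ({e} * UNIV)))"
    (is "(?P1 \<longleftrightarrow> ?P2) \<and> (_ \<longleftrightarrow> ?P3) \<and> (_ \<longleftrightarrow> ?P4) \<and> (_ \<longleftrightarrow> ?P5)")
proof -
  note reg = assms(1)
  have uniq: "right_below b c" if ?P2 "b \<in> inverses a" "c \<in> inverses a" for a b c :: 'a
    using that green_R_regular_iff[OF reg] by blast
  have E: "right_below (e * f) f"
    if ?P3 "e \<in> ordered_idempotents" "f \<in> ordered_idempotents" for e f :: 'a
    using that down_sandwich_right_below by blast
  \<comment> \<open>Three cycles through \<open>?P1\<close> are closed: via \<open>?P2\<close> and
    \<open>?P3\<close>, via \<open>?P2\<close> and \<open>?P4\<close>, and via \<open>?P2\<close>,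
    \<open>?P3\<close> and \<open>?P5\<close>.\<close>
  have "?P1 \<Longrightarrow> ?P2"
    using right_inverse_imp_inverses_right_below[OF reg] green_R_regular_iff[OF reg] by blast
  moreover have ?P3 if P2: ?P2
    by (intro ballI idempotent_mult_in_down[OF reg]) (blast intro: uniq[OF P2])+
  moreover have ?P1 if P3: ?P3
    using right_inverseI[OF reg E[OF P3]] by blast
  moreover have ?P4 if P2: ?P2
    by (intro ballI down_Int_down[OF reg]) (blast intro: uniq[OF P2])+
  moreover have ?P1 if P4: ?P4
  proof (rule right_inverseI[OF reg])
    fix e f :: 'a
    assume "e \<in> ordered_idempotents" "f \<in> ordered_idempotents"
    then have "down ({e} * UNIV) \<inter> down ({f} * UNIV) = down ({e * f} * UNIV)"
      using P4 by blast
    \<comment> \<open>Regularity places \<open>e * f\<close> in its own right ideal, hence in the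
      intersection.\<close>
    moreover have "e * f \<in> down ({e * f} * UNIV)"
      using right_below_refl_regular[OF reg] by (simp add: down_right_iff)
    ultimately show "right_below (e * f) f"
      using down_right_iff by blast
  qed
  moreover have ?P5 if P3: ?P3
    using inverse_right_below[OF E[OF P3]] down_right_iff by blast
  moreover have ?P1 if P5: ?P5
    unfolding right_inverse_iff[OF reg]
  proof (intro ballI impI)
    fix e f :: 'a
    assume e: "e \<in> ordered_idempotents" and f: "f \<in> ordered_idempotents"
      and "principal_left_ideal e = principal_left_ideal f"
    then have "e \<in> down (UNIV * {f})"
      using principal_left_ideal_eqD[OF reg] down_left_iff by blast
    \<comment> \<open>\<open>?P5\<close> is used at \<open>f\<close> with \<open>x = x' = e\<close>,
      as \<open>e\<close> is its own inverse.\<close>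
    then have "e \<in> down ({f} * UNIV)"
      using P5 f idempotent_self_inverse[OF e] by blast
    then show "right_below e f"
      by (simp add: down_right_iff)
  qed
  ultimately show ?thesis
    by argo
qed

end
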